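(* For every $r\geq 2$, the graph $G_r$ is $6$-$\gamma_{tR}$-edge-supercritical.
   Context: All graphs are finite and simple. For $r\geq 2$, $G_r$ is defined as follows. Start with the complete graph $K_{2r}$ on vertices $u_1,\dots,u_r,w_1,\dots,w_r$ and delete the perfect matching $\{u_iw_i:1\leq i\leq r\}$. Add a disjoint triangle on new vertices $x,y,z$. Join $z$ to every $u_i$ and every $w_i$ ($1\leq i\leq r$), and join $y$ to every $u_i$ ($1\leq i\leq r$). Finally add two new vertices $u_0,w_0$ with edges $u_0x$, $w_0y$, $u_0u_i$ and $w_0w_i$ for $1\leq i\leq r$. (So $G_r$ has $2r+5$ vertices.) A total Roman dominating function (TRD-function) on a graph $G$ with no isolated vertices is a function $f:V(G)\to\{0,1,2\}$ such that every vertex $v$ with $f(v)=0$ is adjacent to some $u$ with $f(u)=2$, and the subgraph induced by $\{w:f(w)>0\}$ has no isolated vertices; its weight is $\sum_v f(v)$ and $\gamma_{tR}(G)$ is the minimum weight. A graph $G$ with no isolated vertices is $k$-$\gamma_{tR}$-edge-supercritical if $\gamma_{tR}(G)=k$, $E(\overline{G})\neq\emptyset$, and $\gamma_{tR}(G+e)\leq\gamma_{tR}(G)-2$ for every $e\in E(\overline{G})$. *)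

theory Defs
  imports
    "HOL-Library.FuncSet"
    "Graph_Theory.Digraph"
    "Graph_Theory.Digraph_Component"
    "Graph_Theory.Pair_Digraph"
begin

text \<open>A finite simple graph is a \<^locale>\<open>pair_graph\<close>: an undirected edge is represented by
  its two opposite arcs.\<close>

definition no_isolated_vertices :: "('a, 'b) pre_digraph \<Rightarrow> bool" where
  "no_isolated_vertices G \<longleftrightarrow> (\<forall>v \<in> verts G. \<exists>u. v \<rightarrow>\<^bsub>G\<^esub> u)"

definition complement_graph :: "'a pair_pre_digraph \<Rightarrow> 'a pair_pre_digraph" where
  "complement_graph G =
    \<lparr>pverts = pverts G,
     parcs = {(u, v). u \<in> pverts G \<and> v \<in> pverts G \<and> u \<noteq> v \<and> (u, v) \<notin> parcs G}\<rparr>"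

definition add_edge :: "'a pair_pre_digraph \<Rightarrow> 'a \<times> 'a \<Rightarrow> 'a pair_pre_digraph" where
  "add_edge G e =
    \<lparr>pverts = pverts G, parcs = parcs G \<union> {(fst e, snd e), (snd e, fst e)}\<rparr>"

definition trd_function :: "'a pair_pre_digraph \<Rightarrow> ('a \<Rightarrow> nat) \<Rightarrow> bool" where
  "trd_function G f \<longleftrightarrow>
     f \<in> pverts G \<rightarrow> {0, 1, 2} \<and>
     (\<forall>v \<in> pverts G. f v = 0 \<longrightarrow> (\<exists>u \<in> pverts G. v \<rightarrow>\<^bsub>G\<^esub> u \<and> f u = 2)) \<and>
     no_isolated_vertices (G \<restriction> {w \<in> pverts G. f w > 0})"

definition weight :: "'a pair_pre_digraph \<Rightarrow> ('a \<Rightarrow> nat) \<Rightarrow> nat" where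
  "weight G f = (\<Sum>v \<in> pverts G. f v)"

text \<open>This is the minimum weight whenever \<open>G\<close> has no isolated vertices: the constant function 1
  is then a TRD-function. For other graphs the value is unspecified.\<close>

definition gamma_tR :: "'a pair_pre_digraph \<Rightarrow> nat" where
  "gamma_tR G = (LEAST k. \<exists>f. trd_function G f \<and> weight G f = k)"

text \<open>The last inequality is written additively to avoid truncated subtraction.\<close>

definition edge_supercritical :: "nat \<Rightarrow> 'a pair_pre_digraph \<Rightarrow> bool" where
  "edge_supercritical k G \<longleftrightarrow>
     pair_graph G \<and> no_isolated_vertices G \<and>
     gamma_tR G = k \<and>
     parcs (complement_graph G) \<noteq> {} \<and>
     (\<forall>e \<in> parcs (complement_graph G). gamma_tR (add_edge G e) + 2 \<le> gamma_tR G)"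

datatype vertex = U nat | W nat | X | Y | Z

text \<open>One orientation of each edge suffices below (the clique part happens to contain both);
  \<^const>\<open>mk_symmetric\<close> supplies the opposite arcs.\<close>

definition Gr :: "nat \<Rightarrow> vertex pair_pre_digraph" where
  "Gr r =
    (let K = U ` {1..r} \<union> W ` {1..r};
         M = {(U i, W i) | i. i \<in> {1..r}}
     in mk_symmetric
       \<lparr>pverts = U ` {0..r} \<union> W ` {0..r} \<union> {X, Y, Z},
        parcs =
          ({(a, b). a \<in> K \<and> b \<in> K \<and> a \<noteq> b} - (M \<union> M\<inverse>))
          \<union> {(X, Y), (Y, Z), (X, Z)}
          \<union> {(Z, a) | a. a \<in> K}
          \<union> {(Y, U i) | i. i \<in> {1..r}}
          \<union> {(U 0, X), (W 0, Y)}
          \<union> {(U 0, U i) | i. i \<in> {1..r}}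
          \<union> {(W 0, W i) | i. i \<in> {1..r}}\<rparr>)"

end

theory Submission
  imports Defs
begin

text \<open>
  Twice the indicator of a total dominating set is a TRD-function. The set \<open>{x, y, z}\<close> is total
  dominating in \<open>G\<^sub>r\<close>, and after adding any missing edge some pair of adjacent vertices is, so the
  upper bounds 6 and 4 follow.

  For the lower bound, the closed neighbourhoods of \<open>u\<^sub>0\<close> and \<open>w\<^sub>0\<close> partition \<open>V - {z}\<close>, and every
  TRD-function has weight at least 2 on each. A TRD-function of weight at most 5 therefore has
  \<open>f z \<le> 1\<close> and at most one unit to spare on either part. Since \<open>x\<close> is adjacent only to \<open>y\<close>, \<open>z\<close> and
  \<open>u\<^sub>0\<close>, one of \<open>f y = 2\<close>, \<open>f u\<^sub>0 = 2\<close>, \<open>f x > 0\<close> holds, and each of these leaves some vertex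
  undominated or isolated.
\<close>

section \<open>TRD-functions and total dominating sets\<close>

lemma trd_function_iff:
  "trd_function G f \<longleftrightarrow>
     f \<in> pverts G \<rightarrow> {0, 1, 2} \<and>
     (\<forall>v \<in> pverts G. f v = 0 \<longrightarrow> (\<exists>u \<in> pverts G. (v, u) \<in> parcs G \<and> f u = 2)) \<and>
     (\<forall>v \<in> pverts G. f v > 0 \<longrightarrow> (\<exists>u \<in> pverts G. (v, u) \<in> parcs G \<and> f u > 0))"
  unfolding trd_function_def no_isolated_vertices_def
  by (auto simp: arcs_ends_conv)

lemma gamma_tR_le_twice_card_total_dominating:
  assumes "finite (pverts G)" "S \<subseteq> pverts G"
    and dom: "\<And>v. v \<in> pverts G \<Longrightarrow> \<exists>u\<in>S. (v, u) \<in> parcs G"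
  shows "gamma_tR G \<le> 2 * card S"
proof -
  let ?f = "\<lambda>v. if v \<in> S then 2 else 0 :: nat"
  have "trd_function G ?f"
    unfolding trd_function_iff using assms(2) dom by (auto; blast)
  moreover have "weight G ?f = 2 * card S"
    unfolding weight_def using assms(1,2) by (simp add: sum.If_cases Int_absorb1)
  ultimately show ?thesis
    unfolding gamma_tR_def by (blast intro: Least_le)
qed

section \<open>Vertices, adjacency and weight in \<open>Gr r\<close>\<close>

lemma finite_pverts_Gr: "finite (pverts (Gr r))"
  by (simp add: Gr_def Let_def mk_symmetric_def)

lemma in_pverts_Gr [simp]:
  "U i \<in> pverts (Gr r) \<longleftrightarrow> i \<le> r" "W i \<in> pverts (Gr r) \<longleftrightarrow> i \<le> r"
  "X \<in> pverts (Gr r)" "Y \<in> pverts (Gr r)" "Z \<in> pverts (Gr r)"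
  by (auto simp: Gr_def Let_def mk_symmetric_def)

lemma in_parcs_mk_symmetric:
  "(p, q) \<in> parcs (mk_symmetric (with_proj G)) \<longleftrightarrow> (p, q) \<in> parcs G \<or> (q, p) \<in> parcs G"
  by (auto simp: parcs_mk_symmetric intro: rev_bexI)

text \<open>Since \<open>U 0\<close> is joined to every other \<open>U i\<close>, and
  \<open>W 0\<close> to every other \<open>W i\<close>, each kind forms a clique with index 0
  included. For all other pairs index 0 behaves differently from the positive indices.\<close>

lemma in_parcs_Gr [simp]:
  "(U i, U j) \<in> parcs (Gr r) \<longleftrightarrow> i \<noteq> j \<and> i \<le> r \<and> j \<le> r"
  "(W i, W j) \<in> parcs (Gr r) \<longleftrightarrow> i \<noteq> j \<and> i \<le> r \<and> j \<le> r"
  "(U i, W j) \<in> parcs (Gr r) \<longleftrightarrow> i \<noteq> j \<and> i \<in> {1..r} \<and> j \<in> {1..r}"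
  "(W i, U j) \<in> parcs (Gr r) \<longleftrightarrow> i \<noteq> j \<and> i \<in> {1..r} \<and> j \<in> {1..r}"
  "(U i, X) \<in> parcs (Gr r) \<longleftrightarrow> i = 0" "(X, U i) \<in> parcs (Gr r) \<longleftrightarrow> i = 0"
  "(U i, Y) \<in> parcs (Gr r) \<longleftrightarrow> i \<in> {1..r}" "(Y, U i) \<in> parcs (Gr r) \<longleftrightarrow> i \<in> {1..r}"
  "(U i, Z) \<in> parcs (Gr r) \<longleftrightarrow> i \<in> {1..r}" "(Z, U i) \<in> parcs (Gr r) \<longleftrightarrow> i \<in> {1..r}"
  "(W i, X) \<notin> parcs (Gr r)" "(X, W i) \<notin> parcs (Gr r)"
  "(W i, Y) \<in> parcs (Gr r) \<longleftrightarrow> i = 0" "(Y, W i) \<in> parcs (Gr r) \<longleftrightarrow> i = 0"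
  "(W i, Z) \<in> parcs (Gr r) \<longleftrightarrow> i \<in> {1..r}" "(Z, W i) \<in> parcs (Gr r) \<longleftrightarrow> i \<in> {1..r}"
  "(X, X) \<notin> parcs (Gr r)" "(Y, Y) \<notin> parcs (Gr r)" "(Z, Z) \<notin> parcs (Gr r)"
  "(X, Y) \<in> parcs (Gr r)" "(Y, X) \<in> parcs (Gr r)"
  "(X, Z) \<in> parcs (Gr r)" "(Z, X) \<in> parcs (Gr r)"
  "(Y, Z) \<in> parcs (Gr r)" "(Z, Y) \<in> parcs (Gr r)"
  unfolding Gr_def Let_def in_parcs_mk_symmetric by (auto simp: image_iff)

lemma parcs_Gr_ends:
  assumes "(u, v) \<in> parcs (Gr r)"
  shows "u \<in> pverts (Gr r)" "v \<in> pverts (Gr r)" "u \<noteq> v"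
  using assms by (cases u; cases v; auto)+

lemma pair_graph_Gr: "pair_graph (Gr r)"
proof
  show "fst e \<in> pverts (Gr r)" "snd e \<in> pverts (Gr r)" "fst e \<noteq> snd e"
    if "e \<in> parcs (Gr r)" for e
    using parcs_Gr_ends[of "fst e" "snd e"] that by auto
next
  show "finite (pverts (Gr r))" by (rule finite_pverts_Gr)
next
  have "parcs (Gr r) \<subseteq> pverts (Gr r) \<times> pverts (Gr r)"
    using parcs_Gr_ends by auto
  then show "finite (parcs (Gr r))"
    by (rule finite_subset) (simp add: finite_pverts_Gr)
next
  have "(v, u) \<in> parcs (Gr r)" if "(u, v) \<in> parcs (Gr r)" for u v
    using that by (cases u; cases v) auto
  then show "symmetric (Gr r)"
    by (auto simp: symmetric_def intro!: symI)
qed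

text \<open>The two brackets collect the closed neighbourhoods of \<open>U 0\<close> and
  \<open>W 0\<close>; only \<open>Z\<close> lies outside both.\<close>

lemma weight_Gr:
  "weight (Gr r) f =
    (f X + f (U 0) + (\<Sum>i\<in>{1..r}. f (U i))) + (f Y + f (W 0) + (\<Sum>i\<in>{1..r}. f (W i))) + f Z"
proof -
  have V: "pverts (Gr r) = U ` {0..r} \<union> W ` {0..r} \<union> {X, Y, Z}"
    by (simp add: Gr_def Let_def mk_symmetric_def)
  have "weight (Gr r) f = sum f (U ` {0..r}) + sum f (W ` {0..r}) + sum f {X, Y, Z}"
    unfolding weight_def V by (subst sum.union_disjoint; auto)+
  also have "\<dots> = (\<Sum>i\<in>{0..r}. f (U i)) + (\<Sum>i\<in>{0..r}. f (W i)) + (f X + f Y + f Z)"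
    by (simp add: sum.reindex inj_on_def)
  finally show ?thesis
    by (simp add: sum.atLeast_Suc_atMost)
qed

section \<open>The lower bound 6\<close>

text \<open>Splitting off index 0 lets the simplifier turn "some neighbour of \<open>v\<close> has a
  given value" into a list of the neighbours of \<open>v\<close> by type.\<close>

lemma ex_vertex:
  "(\<exists>v. P v) \<longleftrightarrow>
    P (U 0) \<or> (\<exists>i>0. P (U i)) \<or> P (W 0) \<or> (\<exists>i>0. P (W i)) \<or> P X \<or> P Y \<or> P Z"
  by (metis vertex.exhaust gr0I)

lemma all_vertex:
  "(\<forall>v. P v) \<longleftrightarrow> (\<forall>i. P (U i)) \<and> (\<forall>i. P (W i)) \<and> P X \<and> P Y \<and> P Z"
  by (metis vertex.exhaust)

lemma trd_weight_ge_6_Gr: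
  assumes r: "r \<ge> 2" and trd: "trd_function (Gr r) f"
  shows "6 \<le> weight (Gr r) f"
proof (rule ccontr)
  assume light: "\<not> 6 \<le> weight (Gr r) f"
  define a b where "a i = f (U i)" and "b i = f (W i)" for i
  define x y z where "x = f X" and "y = f Y" and "z = f Z"
  note defs = a_def b_def x_def y_def z_def
  define s t where "s = sum a {1..r}" and "t = sum b {1..r}"
  have dom: "\<exists>u. u \<in> pverts (Gr r) \<and> (v, u) \<in> parcs (Gr r) \<and> f u = 2"
    if "v \<in> pverts (Gr r)" "f v = 0" for v
    using trd that unfolding trd_function_iff by blast
  have tot: "\<exists>u. u \<in> pverts (Gr r) \<and> (v, u) \<in> parcs (Gr r) \<and> f u > 0"
    if "v \<in> pverts (Gr r)" "f v > 0" for v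
    using trd that unfolding trd_function_iff by blast
  have total: "(x + a 0 + s) + (y + b 0 + t) + z \<le> 5"
    using light by (simp add: weight_Gr defs s_def t_def)
  have le2: "f v \<le> 2" if "v \<in> pverts (Gr r)" for v
  proof -
    have "f v \<in> {0, 1, 2}" using trd that unfolding trd_function_iff by (blast dest: funcset_mem)
    then show ?thesis by auto
  qed
  have bounds: "x \<le> 2" "y \<le> 2" "z \<le> 2" "a 0 \<le> 2" "b 0 \<le> 2"
    by (auto simp: defs intro: le2)
  have s1: "a i \<le> s" and t1: "b i \<le> t" if "i \<in> {1..r}" for i
    using that by (auto simp: s_def t_def intro: member_le_sum)
  have pair: "g i + g j \<le> sum g {1..r}" if "i \<in> {1..r}" "j \<in> {1..r}" "i \<noteq> j"
    for g :: "nat \<Rightarrow> nat" and i j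
    using sum_mono2[of "{1..r}" "{i, j}" g] that by simp
  have s2: "a i + a j \<le> s" and t2: "b i + b j \<le> t"
    if "i \<in> {1..r}" "j \<in> {1..r}" "i \<noteq> j" for i j
    using pair[of i j] that by (auto simp: s_def t_def)
  \<comment> \<open>The facts down to \<open>W_tot\<close> read off neighbourhoods:
    \<open>_dom\<close> concerns value 0, \<open>_tot\<close> a positive value. The condition
    \<open>i \<noteq> k\<close> in the later ones also excludes the partner of vertex
    \<open>k\<close> in the deleted matching.\<close>
  have U0_dom: "x = 2 \<or> (\<exists>i\<in>{1..r}. a i = 2)" if "a 0 = 0"
    using dom[unfolded ex_vertex, of "U 0"] that by (auto simp: defs Suc_le_eq)
  have U0_tot: "x > 0 \<or> (\<exists>i\<in>{1..r}. a i > 0)" if "a 0 > 0"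
    using tot[unfolded ex_vertex, of "U 0"] that by (auto simp: defs Suc_le_eq)
  have W0_dom: "y = 2 \<or> (\<exists>i\<in>{1..r}. b i = 2)" if "b 0 = 0"
    using dom[unfolded ex_vertex, of "W 0"] that by (auto simp: defs Suc_le_eq)
  have W0_tot: "y > 0 \<or> (\<exists>i\<in>{1..r}. b i > 0)" if "b 0 > 0"
    using tot[unfolded ex_vertex, of "W 0"] that by (auto simp: defs Suc_le_eq)
  have X_dom: "y = 2 \<or> z = 2 \<or> a 0 = 2" if "x = 0"
    using dom[unfolded ex_vertex, of X] that by (auto simp: defs)
  have X_tot: "y > 0 \<or> z > 0 \<or> a 0 > 0" if "x > 0"
    using tot[unfolded ex_vertex, of X] that by (auto simp: defs)
  have Y_dom: "x = 2 \<or> z = 2 \<or> b 0 = 2 \<or> (\<exists>i\<in>{1..r}. a i = 2)" if "y = 0"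
    using dom[unfolded ex_vertex, of Y] that by (auto simp: defs)
  have U_dom: "a 0 = 2 \<or> y = 2 \<or> z = 2 \<or> (\<exists>i\<in>{1..r}. i \<noteq> k \<and> (a i = 2 \<or> b i = 2))"
    if "a k = 0" "k \<in> {1..r}" for k
    using dom[unfolded ex_vertex, of "U k"] that
    by (auto simp: defs Suc_le_eq)
  have W_dom: "b 0 = 2 \<or> z = 2 \<or> (\<exists>i\<in>{1..r}. i \<noteq> k \<and> (a i = 2 \<or> b i = 2))"
    if "b k = 0" "k \<in> {1..r}" for k
    using dom[unfolded ex_vertex, of "W k"] that
    by (auto simp: defs Suc_le_eq)
  have W_tot: "b 0 > 0 \<or> z > 0 \<or> (\<exists>i\<in>{1..r}. i \<noteq> k \<and> (a i > 0 \<or> b i > 0))"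
    if "b k > 0" "k \<in> {1..r}" for k
    using tot[unfolded ex_vertex, of "W k"] that
    by (auto simp: defs Suc_le_eq)
  \<comment> \<open>If \<open>a 0 = 0\<close>, some neighbour of \<open>U 0\<close> has value 2;
    otherwise \<open>U 0\<close> and a positive neighbour contribute at least 1 each.\<close>
  have A: "x + a 0 + s \<ge> 2"
    using U0_dom U0_tot s1 by (cases "a 0 = 0") fastforce+
  have B: "y + b 0 + t \<ge> 2"
    using W0_dom W0_tot t1 by (cases "b 0 = 0") fastforce+
  have z: "z \<le> 1" using A B total by linarith
  have r12: "1 \<in> {1..r}" "2 \<in> {1..r}" using r by auto
  \<comment> \<open>The indices 1 and 2 exist because \<open>r \<ge> 2\<close>, and two positive
    values would already sum to 2.\<close>
  have t_zero: "\<exists>k\<in>{1..r}. b k = 0" if "t \<le> 1"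
  proof (rule ccontr)
    assume "\<not> ?thesis"
    then have "b 1 > 0" "b 2 > 0" using r12 by auto
    then show False using t2[OF r12] that by linarith
  qed
  have s_zero: "\<exists>k\<in>{1..r}. a k = 0" if "s \<le> 1"
  proof (rule ccontr)
    assume "\<not> ?thesis"
    then have "a 1 > 0" "a 2 > 0" using r12 by auto
    then show False using s2[OF r12] that by linarith
  qed
  consider (y) "y = 2" | (u0) "y \<noteq> 2" "a 0 = 2" | (x) "y \<noteq> 2" "a 0 \<noteq> 2" "x > 0"
    using X_dom z by fastforce
  then show False
  proof cases
    case y
    then have bt: "b 0 + t \<le> 1" "s \<le> 3" using A B total by linarith+
    then have no_b: "b i < 2" if "i \<in> {1..r}" for i using t1[OF that] by linarith
    obtain k where "k \<in> {1..r}" "b k = 0" using t_zero bt by auto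
    \<comment> \<open>Only some \<open>U m\<close> can dominate \<open>W k\<close>. As
      \<open>U m\<close> is not adjacent to \<open>W m\<close> and no other candidate has value 2,
      \<open>W m\<close> must itself be positive. That exhausts the weight and leaves
      \<open>W m\<close> without a positive neighbour.\<close>
    then obtain m where m: "m \<in> {1..r}" "a m = 2"
      using W_dom[of k] no_b bt z by fastforce
    have others: "a i < 2" if "i \<in> {1..r}" "i \<noteq> m" for i
      using s2[OF that(1) m(1) that(2)] m bt by linarith
    have bm: "b m > 0"
      using W_dom[of m] no_b others m bt z by fastforce
    then have "t \<ge> 1" using t1[OF m(1)] by linarith
    then have "b 0 = 0" "z = 0" "s \<le> 2" "t \<le> 1" using y A bt total by linarith+
    then show False
      using W_tot[OF bm m(1)] s2[OF _ m(1)] t2[OF _ m(1)] m bm by fastforce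
  next
    case u0
    have "x + s \<ge> 1" using U0_tot u0 s1 by fastforce
    then have eqs: "x + s = 1" "y + b 0 + t = 2" "z = 0"
      using u0 B total by linarith+
    then have no_a: "a i < 2" if "i \<in> {1..r}" for i using s1[OF that] by linarith
    show False
    proof (cases "b 0 = 0")
      case True
      then obtain j where "j \<in> {1..r}" "b j = 2" using W0_dom u0 by auto
      \<comment> \<open>All of the weight 2 on the closed neighbourhood of \<open>W 0\<close> sits
        on \<open>W j\<close>, so nothing dominates \<open>Y\<close>.\<close>
      then have "y = 0" using t1[of j] eqs by linarith
      then show False using Y_dom eqs True no_a by fastforce
    next
      case False
      have "y + t \<ge> 1" using W0_tot False t1 by fastforce
      then have b0: "b 0 = 1" "t \<le> 1" using False eqs by linarith+
      then obtain k where "k \<in> {1..r}" "b k = 0" using t_zero by auto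
      then obtain i where "i \<in> {1..r}" "b i = 2" using W_dom[of k] no_a b0 eqs by fastforce
      then show False using t1[of i] b0 by linarith
    qed
  next
    case x
    show False
    proof (cases "\<exists>m\<in>{1..r}. a m = 2")
      case True
      then obtain m where m: "m \<in> {1..r}" "a m = 2" by blast
      have eqs: "x = 1" "a 0 = 0" "s = 2" "y + b 0 + t = 2" "z = 0"
        using s1[OF m(1)] m x B total by linarith+
      have "y = 1" using X_tot x eqs bounds by linarith
      then have no_b: "b i < 2" if "i \<in> {1..r}" for i using t1[OF that] eqs by linarith
      have "b 0 > 0" using W0_dom no_b \<open>y = 1\<close> by fastforce
      then have b: "b 0 = 1" "t = 0" using \<open>y = 1\<close> eqs by linarith+
      \<comment> \<open>\<open>W m\<close> misses \<open>U m\<close>, so a second \<open>U i\<close>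
        of value 2 would be needed, against \<open>s = 2\<close>.\<close>
      then have "b m = 0" using t1[OF m(1)] by linarith
      then obtain i where "i \<in> {1..r}" "i \<noteq> m" "a i = 2"
        using W_dom[of m] m no_b b eqs by fastforce
      then show False using s2[of i m] m eqs by linarith
    next
      case no_a: False
      have U0: "x = 2 \<or> a 0 > 0" using U0_dom no_a by auto
      then have "s \<le> 1" using x B total by linarith
      then obtain k where "k \<in> {1..r}" "a k = 0"
        using s_zero by auto
      then obtain j where j: "j \<in> {1..r}" "b j = 2"
        using U_dom[of k] no_a x z by fastforce
      have tj: "t \<ge> 2" "t \<le> 3" using t1[OF j(1)] j A total by linarith+
      \<comment> \<open>\<open>W j\<close> does not dominate its partner \<open>U j\<close>, and
        \<open>t \<le> 3\<close> rules out a second \<open>W i\<close> of value 2. Making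
        \<open>U j\<close> positive uses up the weight, and \<open>W j\<close> becomes
        isolated.\<close>
      have "a j > 0"
        using U_dom[of j] j no_a x z t2[of _ j] tj by fastforce
      then have "s \<ge> 1" using s1[OF j(1)] by linarith
      then have eqs: "x + a 0 = 2" "s = 1" "y = 0" "b 0 = 0" "t = 2" "z = 0"
        using U0 x tj total by linarith+
      then show False
        using W_tot[of j] j \<open>a j > 0\<close> s2[of _ j] t2[of _ j] by fastforce
    qed
  qed
qed

section \<open>Upper bounds after adding an edge\<close>

text \<open>The missing edges fall into eleven families, each listed in one orientation;
  \<open>sym\<close> supplies the other.\<close>

lemma non_arc_Gr_cases [consumes 1, case_names
    sym U_W U_W0 W_U0 U0_W0 U_X W_X W0_X W_Y U0_Y U0_Z W0_Z]:
  assumes "(p, q) \<in> parcs (complement_graph (Gr r))"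
    and "\<And>p q. P p q \<Longrightarrow> P q p"
    and "\<And>i. i \<in> {1..r} \<Longrightarrow> P (U i) (W i)"
    and "\<And>i. i \<in> {1..r} \<Longrightarrow> P (U i) (W 0)"
    and "\<And>i. i \<in> {1..r} \<Longrightarrow> P (W i) (U 0)"
    and "P (U 0) (W 0)"
    and "\<And>i. i \<in> {1..r} \<Longrightarrow> P (U i) X"
    and "\<And>i. i \<in> {1..r} \<Longrightarrow> P (W i) X"
    and "P (W 0) X"
    and "\<And>i. i \<in> {1..r} \<Longrightarrow> P (W i) Y"
    and "P (U 0) Y"
    and "P (U 0) Z"
    and "P (W 0) Z"
  shows "P p q"
proof -
  have nonarc: "p \<in> pverts (Gr r)" "q \<in> pverts (Gr r)" "p \<noteq> q" "(p, q) \<notin> parcs (Gr r)"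
    using assms(1) by (auto simp: complement_graph_def)
  have UW: "P (U i) (W j)" if "i \<le> r" "j \<le> r" "(U i, W j) \<notin> parcs (Gr r)" for i j
    using that assms(2-6) by (cases "i = 0"; cases "j = 0") auto
  have UX: "P (U i) X" if "i \<le> r" "i \<noteq> 0" for i
    using that assms(7) by auto
  have WX: "P (W i) X" if "i \<le> r" for i
    using that assms(8,9) by (cases "i = 0") auto
  have WY: "P (W i) Y" if "i \<le> r" "i \<noteq> 0" for i
    using that assms(10) by auto
  have UY: "P (U i) Y" if "i \<le> r" "i \<notin> {1..r}" for i
    using that assms(11) by (cases "i = 0") auto
  have UZ: "P (U i) Z" if "i \<le> r" "i \<notin> {1..r}" for i
    using that assms(12) by (cases "i = 0") auto
  have WZ: "P (W i) Z" if "i \<le> r" "i \<notin> {1..r}" for i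
    using that assms(13) by (cases "i = 0") auto
  note rules = UW UX WX WY UY UZ WZ
  show ?thesis
    using nonarc by (cases p; cases q) (auto intro: rules rules[THEN assms(2)])
qed

lemma gamma_tR_add_edge_Gr_le:
  assumes r: "r \<ge> 2" and "(p, q) \<in> parcs (complement_graph (Gr r))"
  shows "gamma_tR (add_edge (Gr r) (p, q)) \<le> 4"
proof -
  have pairI: "gamma_tR (add_edge (Gr r) (p, q)) \<le> 4"
    if "c \<in> pverts (Gr r)" "d \<in> pverts (Gr r)" "c \<noteq> d"
      and dom: "\<forall>v. v \<in> pverts (Gr r) \<longrightarrow>
        v = p \<and> (c = q \<or> d = q) \<or> v = q \<and> (c = p \<or> d = p) \<or>
        (v, c) \<in> parcs (Gr r) \<or> (v, d) \<in> parcs (Gr r)"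
    for c d p q
  proof -
    have "gamma_tR (add_edge (Gr r) (p, q)) \<le> 2 * card {c, d}"
    proof (rule gamma_tR_le_twice_card_total_dominating)
      fix v assume "v \<in> pverts (add_edge (Gr r) (p, q))"
      then show "\<exists>u\<in>{c, d}. (v, u) \<in> parcs (add_edge (Gr r) (p, q))"
        using dom by (auto simp: add_edge_def)
    qed (use that in \<open>auto simp: add_edge_def finite_pverts_Gr\<close>)
    then show ?thesis using that by simp
  qed
  \<comment> \<open>A second index makes \<open>U i\<close> and \<open>W j\<close> adjacent,
    avoiding the deleted matching.\<close>
  have other: "\<exists>j\<in>{1..r}. j \<noteq> i" for i :: nat
    using r by (intro bexI[of _ "if i = 1 then 2 else 1"]) auto
  \<comment> \<open>Each pair below is adjacent in \<open>Gr r\<close> and totally dominates all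
    vertices but one. That vertex is an end of the new edge, whose other end lies in the
    pair.\<close>
  show ?thesis
    using assms(2)
  proof (induction rule: non_arc_Gr_cases)
    case (sym p q)
    then show ?case by (simp add: add_edge_def insert_commute)
  next
    case (U_W i)
    show ?case by (intro pairI[of "U i" Y]) (use U_W in \<open>auto simp: all_vertex\<close>)
  next
    case (U_W0 i)
    show ?case by (intro pairI[of "U i" Z]) (use U_W0 in \<open>auto simp: all_vertex\<close>)
  next
    case (W_U0 i)
    show ?case by (intro pairI[of "W i" Z]) (use W_U0 in \<open>auto simp: all_vertex\<close>)
  next
    case U0_W0
    show ?case by (intro pairI[of "W 0" Y]) (auto simp: all_vertex)
  next
    case (U_X i)
    obtain j where "j \<in> {1..r}" "j \<noteq> i" using other by blast
    then show ?case by (intro pairI[of "U i" "W j"]) (use U_X in \<open>auto simp: all_vertex\<close>)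
  next
    case (W_X i)
    obtain j where "j \<in> {1..r}" "j \<noteq> i" using other by blast
    then show ?case by (intro pairI[of "W i" "U j"]) (use W_X in \<open>auto simp: all_vertex\<close>)
  next
    case W0_X
    show ?case by (intro pairI[of X Z]) (auto simp: all_vertex)
  next
    case (W_Y i)
    show ?case by (intro pairI[of "U i" Y]) (use W_Y in \<open>auto simp: all_vertex\<close>)
  next
    case U0_Y
    show ?case by (intro pairI[of Y Z]) (auto simp: all_vertex)
  next
    case U0_Z
    show ?case by (intro pairI[of Y Z]) (auto simp: all_vertex)
  next
    case W0_Z
    show ?case by (intro pairI[of X Z]) (auto simp: all_vertex)
  qed
qed

section \<open>The exact value and the conclusion\<close>

lemma total_dominating_XYZ_Gr:
  assumes "v \<in> pverts (Gr r)"
  shows "\<exists>u\<in>{X, Y, Z}. (v, u) \<in> parcs (Gr r)"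
  using assms by (cases v) auto

lemma gamma_tR_Gr:
  assumes "r \<ge> 2"
  shows "gamma_tR (Gr r) = 6"
proof (rule antisym)
  show "gamma_tR (Gr r) \<le> 6"
    using gamma_tR_le_twice_card_total_dominating[of "Gr r" "{X, Y, Z}"]
    by (simp add: finite_pverts_Gr total_dominating_XYZ_Gr del: bex_simps)
  \<comment> \<open>Some TRD-function must exist for the \<open>LEAST\<close> in
    \<open>gamma_tR\<close> to be an attained weight.\<close>
  have "trd_function (Gr r) (\<lambda>_. 1)"
    unfolding trd_function_iff
    using total_dominating_XYZ_Gr by fastforce
  then have "\<exists>f. trd_function (Gr r) f \<and> weight (Gr r) f = gamma_tR (Gr r)"
    unfolding gamma_tR_def by (rule_tac LeastI_ex) blast
  then show "6 \<le> gamma_tR (Gr r)"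
    using trd_weight_ge_6_Gr[OF assms] by metis
qed

theorem theorem6p3:
  fixes r :: nat
  assumes "r \<ge> 2"
  shows "edge_supercritical 6 (Gr r)"
  unfolding edge_supercritical_def
proof (intro conjI ballI)
  show "pair_graph (Gr r)" by (rule pair_graph_Gr)
  show "no_isolated_vertices (Gr r)"
    unfolding no_isolated_vertices_def using total_dominating_XYZ_Gr by fastforce
  show "gamma_tR (Gr r) = 6" by (rule gamma_tR_Gr[OF assms])
  have "(U 0, W 0) \<in> parcs (complement_graph (Gr r))"
    by (simp add: complement_graph_def)
  then show "parcs (complement_graph (Gr r)) \<noteq> {}" by blast
  show "gamma_tR (add_edge (Gr r) e) + 2 \<le> gamma_tR (Gr r)"
    if "e \<in> parcs (complement_graph (Gr r))" for e
    using gamma_tR_add_edge_Gr_le[OF assms, of "fst e" "snd e"] gamma_tR_Gr[OF assms] that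
    by simp
qed

end
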